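(* Let $\lambda_1<\dots<\lambda_s$ be the characteristic exponents of a germ $Y$ of irreducible plane curve with tangent cone $\{y=0\}$, with truncated parametrizations $\iota_1,\dots,\iota_s$, sets $N_i\subset\mathbb N_0^2$, Weierstrass polynomials $f_1,\dots,f_s\in\mathbb C[x][y]$ satisfying $\iota_i^{*}f_i=0$ and $\mathrm{Supp}(f_i)\subseteq N_i$, $f_0(x,y)=y$, valuations $\vartheta_{\iota_j}$ and semigroup generators $\gamma^{(j)}_i$, all as defined in the context. Then for all $i\in\{1,\dots,s\}$ the following hold. (A) There is $\delta_i\in\mathbb C[x,y]$ such that $\mathrm{Supp}(\delta_i)\subset N_i\setminus\{(0,e_i)\}$ and $f_i(x,y)=f_{i-1}^{k_i}(x,y)+\delta_i(x,y)$. (B) For all $j\in\{i,\dots,s\}$, $\vartheta_{\iota_j}(f_{i-1})=\gamma_i^{(j)}$ and $\vartheta_{\iota_j}(\partial_y f_{i-1})=\gamma_i^{(j)}-e_j\lambda_i$. Furthermore, if $g_i\in\mathbb C[x,y]$ is a nonzero polynomial such that $\iota_i^{*}g_i=0$ and $\mathrm{Supp}(g_i)\subseteq N_i$, then there is $a\in\mathbb C^{*}$ such that $g_i=af_i$.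
   Context: Numerical data. $s\ge 1$ and $\lambda_1<\dots<\lambda_s$ are positive rational numbers with $\lambda_1>1$. Put $M_0=\mathbb Z$, $M_i=M_{i-1}+\mathbb Z\lambda_i$; it is assumed that $\lambda_i\notin M_{i-1}$ for all $i$. Let $k_i$ be the smallest positive integer with $k_i\lambda_i\in M_{i-1}$, $e_0=1$, $e_i=k_ie_{i-1}$, $k=e_s=k_1\cdots k_s$. For $1\le i\le s$ put $\gamma_1^{(i)}=e_i\lambda_1$ and $\gamma_{j+1}^{(i)}=k_j\gamma_j^{(i)}-e_i\lambda_j+e_i\lambda_{j+1}$ for $j=1,\dots,i-1$ (together with $e_i$ these generate the semigroup $\Gamma(\lambda_1,\dots,\lambda_i)$). Parametrization. $Y$ is the germ at the origin of an irreducible plane curve of multiplicity $k$, with tangent cone $\{y=0\}$ and characteristic exponents $\lambda_1,\dots,\lambda_s$, parametrized by $$\iota:\ x=t^k,\quad y=c_1t^{k\lambda_1}+\varphi_1(t)+c_2t^{k\lambda_2}+\varphi_2(t)+\dots+c_st^{k\lambda_s}+\psi(t),$$ where $c_1,\dots,c_s\in\mathbb C^{*}$, $\varphi_1,\dots,\varphi_{s-1}\in t\,\mathbb C[t]$, $\psi\in t\,\mathbb C\{t\}$ (each $\varphi_i$ and $\psi$ may be zero); every exponent occurring in $\varphi_i$ ($i<s$) lies in $kM_i$, is $>k\lambda_i$ and $<k\lambda_{i+1}$; every exponent occurring in $\psi$ lies in $kM_s$ and is $>k\lambda_s$. Let $\varphi_s\in\mathbb C[t]$ be a polynomial (possibly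 zero) with $\mathrm{Supp}(\varphi_s)\subseteq\mathrm{Supp}(\psi)$, where $\mathrm{Supp}$ of a power series is the set of exponents of monomials with nonzero coefficient. For $i=1,\dots,s$ let $\iota_i$ be the polynomial parametrization $$\iota_i:\ x=t^{e_i},\quad y=c_1t^{e_i\lambda_1}+\varphi_1(t^{e_i/k})+\dots+c_it^{e_i\lambda_i}+\varphi_i(t^{e_i/k}).$$ For $g\in\mathbb C[[x,y]]$, $\iota_i^{*}g\in\mathbb C[[t]]$ is obtained by substituting this parametrization, and $\vartheta_{\iota_i}(g)=\mathrm{ord}_t(\iota_i^{*}g)\in\mathbb N_0\cup\{+\infty\}$ (with $\mathrm{ord}(0)=+\infty$). The sets $N_i$. Let $\mu_i=\frac1{e_i}\deg\big(\varphi_i(t^{e_i/k})\big)$ if $\varphi_i\ne 0$ and $\mu_i=\lambda_i$ otherwise. Then $$N_i=\{(\alpha,\beta)\in\mathbb N_0^2:\ k_1\alpha+(k_1\lambda_1)\beta\ge e_i(k_1\lambda_1)\ \text{and}\ e_i\alpha+(e_i\mu_i)\beta\le e_i(e_i\mu_i)\},$$ i.e. the integer points of the convex hull of $\{(0,e_i),(e_i\lambda_1,0),(e_i\mu_i,0)\}$. The polynomials $f_i$. By a known implicitization theorem (D'Andrea–Sombra), for each $i\in\{1,\dots,s\}$ there is a polynomial $f_i\in\mathbb C[x,y]$ with $\iota_i^{*}f_i=0$, $\mathrm{Supp}(f_i)\subseteq N_i$, defining the irreducible curve germ $Y_i$ parametrized by $\iota_i$, and normalized to be a Weierstrass polynomial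 in $y$ of degree $e_i$, i.e. $f_i=y^{e_i}+\sum_{\ell<e_i}a_\ell(x)y^\ell$ with $a_\ell\in\mathbb C[x]$, $a_\ell(0)=0$. Fix such $f_i$, and let $f_0(x,y)=y$. $\partial_y$ denotes partial derivative with respect to $y$. *)

theory Defs
  imports
    "HOL-Computational_Algebra.Computational_Algebra"
    "HOL-Analysis.FPS_Convergence"
    "HOL-Library.Extended_Real"
begin

section \<open>Numerical data attached to the characteristic exponents\<close>

text \<open>A sequence \<open>lam\<close> is only ever used at the indices \<open>1, \<dots>, s\<close>.\<close>

primrec lattice :: "(nat \<Rightarrow> rat) \<Rightarrow> nat \<Rightarrow> rat set" where
  "lattice lam 0 = \<int>"
| "lattice lam (Suc i) = {m + of_int n * lam (Suc i) | m n. m \<in> lattice lam i}"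

definition k_num :: "(nat \<Rightarrow> rat) \<Rightarrow> nat \<Rightarrow> nat" where
  "k_num lam i = (LEAST n. n > 0 \<and> of_nat n * lam i \<in> lattice lam (i - 1))"

primrec e_num :: "(nat \<Rightarrow> rat) \<Rightarrow> nat \<Rightarrow> nat" where
  "e_num lam 0 = 1"
| "e_num lam (Suc i) = k_num lam (Suc i) * e_num lam i"

text \<open>\<open>gamma_num lam i j\<close> is $\gamma_j^{(i)}$; the value at \<open>j = 0\<close> is a dummy.\<close>

fun gamma_num :: "(nat \<Rightarrow> rat) \<Rightarrow> nat \<Rightarrow> nat \<Rightarrow> rat" where
  "gamma_num lam i 0 = 0"
| "gamma_num lam i (Suc 0) = of_nat (e_num lam i) * lam 1"
| "gamma_num lam i (Suc (Suc j)) =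
     of_nat (k_num lam (Suc j)) * gamma_num lam i (Suc j)
       - of_nat (e_num lam i) * lam (Suc j) + of_nat (e_num lam i) * lam (Suc (Suc j))"


section \<open>Supports\<close>

definition poly_supp :: "complex poly \<Rightarrow> nat set" where
  "poly_supp p = {n. coeff p n \<noteq> 0}"

definition fps_supp :: "complex fps \<Rightarrow> nat set" where
  "fps_supp F = {n. fps_nth F n \<noteq> 0}"

text \<open>
  Elements of $\mathbb{C}[x,y] = \mathbb{C}[x][y]$ have type \<open>complex poly poly\<close>: the outer
  variable is $y$ and the inner one $x$. So the coefficient of $x^\alpha y^\beta$ in \<open>f\<close> is
  \<open>coeff (coeff f \<beta>) \<alpha>\<close>, and \<open>pderiv f\<close> is the partial derivative with respect to $y$.
\<close>

definition supp2 :: "complex poly poly \<Rightarrow> (nat \<times> nat) set" where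
  "supp2 f = {(\<alpha>, \<beta>). coeff (coeff f \<beta>) \<alpha> \<noteq> 0}"


section \<open>Parametrizations\<close>

text \<open>
  The exponents $e_i \lambda_j$ ($1 \le j \le i$) are integers, so the rounding is exact.
\<close>

definition char_exp :: "(nat \<Rightarrow> rat) \<Rightarrow> nat \<Rightarrow> nat \<Rightarrow> nat" where
  "char_exp lam i j = nat \<lfloor>of_nat (e_num lam i) * lam j\<rfloor>"

text \<open>
  \<open>subst_frac a b p\<close> is $p(t^{a/b})$. It is used with $a = e_i$, $b = e_s$ and exponents of
  \<open>p\<close> in $e_s M_j$ with $j \le i$, for which the division is exact.
\<close>

definition subst_frac :: "nat \<Rightarrow> nat \<Rightarrow> complex poly \<Rightarrow> complex poly" where
  "subst_frac a b p = (\<Sum>n\<le>degree p. monom (coeff p n) (n * a div b))"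

text \<open>The parametrization $\iota$ of the germ $Y$; here $\varphi_s$ is not used.\<close>

definition iota_full ::
  "nat \<Rightarrow> (nat \<Rightarrow> rat) \<Rightarrow> (nat \<Rightarrow> complex) \<Rightarrow> (nat \<Rightarrow> complex poly) \<Rightarrow> complex fps
     \<Rightarrow> complex fps \<times> complex fps" where
  "iota_full s lam c phi psi =
     (fps_X ^ e_num lam s,
      (\<Sum>j=1..s. fps_const (c j) * fps_X ^ char_exp lam s j)
        + (\<Sum>j=1..<s. fps_of_poly (phi j)) + psi)"

text \<open>The truncated polynomial parametrization $\iota_i$.\<close>

definition iota_trunc ::
  "nat \<Rightarrow> (nat \<Rightarrow> rat) \<Rightarrow> (nat \<Rightarrow> complex) \<Rightarrow> (nat \<Rightarrow> complex poly) \<Rightarrow> nat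
     \<Rightarrow> complex poly \<times> complex poly" where
  "iota_trunc s lam c phi i =
     (monom 1 (e_num lam i),
      \<Sum>j=1..i. monom (c j) (char_exp lam i j) + subst_frac (e_num lam i) (e_num lam s) (phi j))"

definition pullback :: "complex poly \<times> complex poly \<Rightarrow> complex poly poly \<Rightarrow> complex poly" where
  "pullback xy g = poly (map_poly (\<lambda>a. pcompose a (fst xy)) g) (snd xy)"

definition ord_t :: "complex fps \<Rightarrow> enat" where
  "ord_t F = (if F = 0 then \<infinity> else enat (subdegree F))"

definition theta :: "complex poly \<times> complex poly \<Rightarrow> complex poly poly \<Rightarrow> enat" where
  "theta xy g = ord_t (fps_of_poly (pullback xy g))"


section \<open>The sets of lattice points and the Weierstrass polynomials\<close>

definition mu_num :: "nat \<Rightarrow> (nat \<Rightarrow> rat) \<Rightarrow> (nat \<Rightarrow> complex poly) \<Rightarrow> nat \<Rightarrow> rat" where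
  "mu_num s lam phi i =
     (if phi i \<noteq> 0
      then of_nat (degree (subst_frac (e_num lam i) (e_num lam s) (phi i))) / of_nat (e_num lam i)
      else lam i)"

definition N_set :: "nat \<Rightarrow> (nat \<Rightarrow> rat) \<Rightarrow> (nat \<Rightarrow> complex poly) \<Rightarrow> nat \<Rightarrow> (nat \<times> nat) set" where
  "N_set s lam phi i =
     (let k1 = of_nat (k_num lam 1); e = of_nat (e_num lam i); \<mu> = mu_num s lam phi i
      in {(\<alpha>, \<beta>).
            k1 * of_nat \<alpha> + (k1 * lam 1) * of_nat \<beta> \<ge> e * (k1 * lam 1) \<and>
            e * of_nat \<alpha> + (e * \<mu>) * of_nat \<beta> \<le> e * (e * \<mu>)})"

definition weierstrass_poly :: "nat \<Rightarrow> complex poly poly \<Rightarrow> bool" where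
  "weierstrass_poly d f \<longleftrightarrow>
     degree f = d \<and> lead_coeff f = 1 \<and> (\<forall>l<d. poly (coeff f l) 0 = 0)"

end

theory Submission imports Defs begin

text \<open>
  Write $y_i(t)$ for the second component of $\iota_i$. Over $\mathbb{C}[t]$, for $j \ge i$ and
  $d = e_j/e_i$, the polynomial $f_i(t^{e_j}, Y)$ is monic of degree $e_i$ and vanishes at the
  $e_i$ distinct conjugates $y_i(z t^d)$ with $z^{e_i} = 1$; hence it is the product of the
  $Y - y_i(z t^d)$. The same root count shows that a polynomial of degree less than $e_i$ in $y$
  which is annihilated by $\iota_i^*$ is zero, and this gives the uniqueness of $f_i$.

  The factor $y_j(t) - y_i(z t^d)$ has order $e_j \lambda_l$, where $l$ is the least index with
  $z^{e_i/e_l} \ne 1$, and $l = i + 1$ if $z = 1$. This rests on $M_l = e_l^{-1}\mathbb{Z}$ and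
  $\gcd(e_l\lambda_l, k_l) = 1$. Adding up the orders along the chain of the groups
  $z^{e_i/e_l} = 1$ gives $\gamma_{i+1}^{(j)}$. The factor for $z = 1$ has the strictly largest
  order, so in the derivative of the product the summand without it is dominant.
\<close>

section \<open>Polynomials and power series\<close>

lemma coeff_pcompose_monom:
  fixes p :: "'a::comm_ring_1 poly"
  assumes "d > 0"
  shows "coeff (pcompose p (monom z d)) n = (if d dvd n then z ^ (n div d) * coeff p (n div d) else 0)"
proof (induction p arbitrary: n)
  case 0
  show ?case by simp
next
  case (pCons a p)
  show ?case
  proof (cases "n < d")
    case True
    then have "d dvd n \<longleftrightarrow> n = 0" by (auto dest: dvd_imp_le)
    with True assms show ?thesis
      by (auto simp: pcompose_pCons coeff_monom_mult coeff_pCons split: nat.splits)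
  next
    case False
    then obtain m where m: "n = m + d" by (metis add.commute le_Suc_ex not_less)
    have "(m + d) div d = Suc (m div d)" using assms by simp
    with m assms pCons.IH show ?thesis
      by (auto simp: pcompose_pCons coeff_monom_mult coeff_pCons split: nat.splits)
  qed
qed

lemma pcompose_monom_monom:
  fixes z :: "'a::comm_ring_1"
  shows "pcompose (monom a m) (monom z d) = monom (a * z ^ m) (d * m)"
  by (induction m) (auto simp: monom_Suc pcompose_pCons monom_0 mult_monom mult_ac)

text \<open>Reparametrization passes through substitution; with \<open>q\<close> a monomial this
  carries a root in the outer variable to its conjugates.\<close>

lemma pcompose_poly_map_poly_pcompose:
  fixes F :: "'a::comm_ring_1 poly poly"
  shows "pcompose (poly (map_poly (\<lambda>a. pcompose a p) F) y) q =
         poly (map_poly (\<lambda>a. pcompose a (pcompose p q)) F) (pcompose y q)"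
  by (induction F) (auto simp: map_poly_pCons pcompose_add pcompose_mult pcompose_assoc)

lemma pcompose_monom_eq_0_iff:
  fixes p :: "'a::comm_ring_1 poly"
  assumes "d > 0"
  shows "pcompose p (monom 1 d) = 0 \<longleftrightarrow> p = 0"
proof
  assume "pcompose p (monom 1 d) = 0"
  then have "coeff (pcompose p (monom 1 d)) (d * n) = 0" for n by simp
  with assms show "p = 0" by (intro poly_eqI) (simp add: coeff_pcompose_monom)
qed simp

lemma degree_map_poly_pcompose_monom:
  fixes F :: "'a::comm_ring_1 poly poly"
  assumes "d > 0"
  shows "degree (map_poly (\<lambda>a. pcompose a (monom 1 d)) F) = degree F"
  by (rule degree_map_poly) (simp add: assms pcompose_monom_eq_0_iff)

text \<open>The integer factors produced by differentiation are constants, so a substitution in the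
  inner variable leaves them alone.\<close>

lemma pderiv_map_poly_pcompose:
  fixes F :: "'a::idom poly poly"
  shows "pderiv (map_poly (\<lambda>a. pcompose a p) F) = map_poly (\<lambda>a. pcompose a p) (pderiv F)"
proof (rule poly_eqI)
  have "pcompose (of_nat n * a) p = of_nat n * pcompose a p" for n and a :: "'a poly"
    by (simp add: pcompose_smult of_nat_poly)
  then show "coeff (pderiv (map_poly (\<lambda>a. pcompose a p) F)) n =
      coeff (map_poly (\<lambda>a. pcompose a p) (pderiv F)) n" for n
    by (simp add: coeff_pderiv coeff_map_poly del: of_nat_Suc)
qed

lemma poly_eq_0_of_card_roots:
  fixes F :: "'a::idom poly"
  assumes "inj_on r A" and "degree F < card A" and "\<And>a. a \<in> A \<Longrightarrow> poly F (r a) = 0"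
  shows "F = 0"
proof (rule ccontr)
  assume F: "F \<noteq> 0"
  have "card A = card (r ` A)" using assms(1) by (simp add: card_image)
  also have "\<dots> \<le> card {x. poly F x = 0}"
    using assms(3) F by (intro card_mono) (auto simp: poly_roots_finite)
  also have "\<dots> \<le> degree F" using F by (rule card_poly_roots_bound)
  finally show False using assms(2) by simp
qed

text \<open>Two monic polynomials of the same degree differ by one of smaller degree; here the
  difference vanishes at all the \<open>r a\<close>, so the root count makes it zero.\<close>

lemma monic_eq_prod_roots:
  fixes F :: "'a::idom poly"
  assumes "finite A" and "inj_on r A" and "degree F = card A" and "lead_coeff F = 1"
    and "\<And>a. a \<in> A \<Longrightarrow> poly F (r a) = 0"
  shows "F = (\<Prod>a\<in>A. [:- r a, 1:])"
\<comment> \<open>A drop of the degree below \<open>card A\<close> requires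
  \<open>card A > 0\<close>, hence the separate constant case.\<close>
proof (cases "A = {}")
  case True
  with assms(3) obtain b where "F = [:b:]" by (auto elim: degree_eq_zeroE)
  with True assms(4) show ?thesis by (simp add: one_pCons)
next
  case False
  let ?G = "\<Prod>a\<in>A. [:- r a, 1:]"
  have deg: "degree ?G = card A" by (subst degree_prod_sum_eq) auto
  have lead: "lead_coeff ?G = 1" by (simp add: lead_coeff_prod)
  have "card A > 0" using False assms(1) by (simp add: card_gt_0_iff)
  have "F - ?G = 0"
  proof (rule poly_eq_0_of_card_roots[OF assms(2)])
    have "coeff (F - ?G) (card A) = 0" using deg lead assms(3,4) by simp
    moreover have "degree (F - ?G) \<le> card A" using deg assms(3) by (intro degree_diff_le) auto
    ultimately show "degree (F - ?G) < card A"
      by (metis \<open>card A > 0\<close> degree_0 le_neq_implies_less leading_coeff_0_iff)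
    show "poly (F - ?G) (r a) = 0" if "a \<in> A" for a
      using that assms(1,5) by (auto simp: poly_prod intro!: prod_zero)
  qed
  then show ?thesis by simp
qed

text \<open>Up to and including the order of \<open>g b\<close>, all other summands have zero
  coefficients, so nothing can cancel its leading term.\<close>

lemma fps_sum_dominant:
  fixes g :: "'b \<Rightarrow> 'a::comm_ring_1 fps"
  assumes "finite A" and "b \<in> A" and "g b \<noteq> 0"
    and "\<And>a. a \<in> A - {b} \<Longrightarrow> subdegree (g b) < subdegree (g a)"
  shows "sum g A \<noteq> 0" and "subdegree (sum g A) = subdegree (g b)"
proof -
  have *: "fps_nth (sum g A) n = fps_nth (g b) n" if "n \<le> subdegree (g b)" for n
  proof -
    have "fps_nth (g a) n = 0" if "a \<in> A - {b}" for a
      using assms(4)[OF that] \<open>n \<le> subdegree (g b)\<close> by (intro nth_less_subdegree_zero) simp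
    then have "(\<Sum>a\<in>A - {b}. fps_nth (g a) n) = 0" by (intro sum.neutral) auto
    with assms(1,2) show ?thesis by (simp add: fps_sum_nth sum.remove[of A b])
  qed
  from *[of "subdegree (g b)"] assms(3) have nz: "fps_nth (sum g A) (subdegree (g b)) \<noteq> 0" by simp
  then show "sum g A \<noteq> 0" by auto
  show "subdegree (sum g A) = subdegree (g b)"
    using nz * by (intro subdegreeI) auto
qed

section \<open>The lattices and the numbers $k_i$, $e_i$, $\gamma_j^{(i)}$\<close>

text \<open>Here \<open>k_num lam (Suc l)\<close> is the denominator of
  \<open>of_nat (e_num lam l) * lam (Suc l)\<close> in lowest terms, and \<open>p\<close> is the
  numerator. The description of \<open>lattice lam l\<close> is a hypothesis because it is supplied
  by the induction that follows.\<close>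

lemma k_num_props:
  assumes e: "e_num lam l > 0"
    and lat: "\<And>q. q \<in> lattice lam l \<longleftrightarrow> of_nat (e_num lam l) * q \<in> \<int>"
  shows "k_num lam (Suc l) > 0"
    and "\<exists>p. coprime p (int (k_num lam (Suc l))) \<and>
             of_nat (e_num lam (Suc l)) * lam (Suc l) = of_int p"
proof -
  let ?x = "of_nat (e_num lam l) * lam (Suc l)"
  obtain p q where pq: "quotient_of ?x = (p, q)" by fastforce
  have q: "q > 0" and cop: "coprime p q" using pq quotient_of_denom_pos quotient_of_coprime by blast+
  have x: "?x = of_int p / of_int q" using pq by (rule quotient_of_div)
  have k: "k_num lam (Suc l) = nat q"
    unfolding k_num_def
  proof (rule Least_equality)
    have "of_nat (nat q) * ?x = of_int p" using q by (simp add: x)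
    then have "of_nat (e_num lam l) * (of_nat (nat q) * lam (Suc l)) \<in> \<int>"
      by (simp add: mult_ac)
    with q show "0 < nat q \<and> of_nat (nat q) * lam (Suc l) \<in> lattice lam (Suc l - 1)"
      by (simp add: lat)
  next
    fix n assume n: "0 < n \<and> of_nat n * lam (Suc l) \<in> lattice lam (Suc l - 1)"
    then have "of_nat (e_num lam l) * (of_nat n * lam (Suc l)) \<in> \<int>" using lat by simp
    then obtain z where "of_nat (e_num lam l) * (of_nat n * lam (Suc l)) = of_int z"
      by (auto elim: Ints_cases)
    then have "of_nat n * ?x = of_int z" by (simp only: mult_ac)
    then have "of_nat n * (of_int p / of_int q) = (of_int z :: rat)" by (simp only: x)
    then have "(of_int (int n * p) :: rat) = of_int (z * q)" using q by (simp add: field_simps)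
    then have "int n * p = z * q" by (simp only: of_int_eq_iff)
    then have "q dvd int n * p" by simp
    then have "q dvd int n" using cop by (metis coprime_commute coprime_dvd_mult_left_iff)
    with n show "nat q \<le> n" by (meson nat_le_iff of_nat_0_less_iff zdvd_imp_le)
  qed
  show "k_num lam (Suc l) > 0" using k q by simp
  have "of_nat (e_num lam (Suc l)) * lam (Suc l) = of_int q * ?x" using k q by simp
  also have "\<dots> = of_int p" using q by (simp add: x)
  finally show "\<exists>p. coprime p (int (k_num lam (Suc l))) \<and>
             of_nat (e_num lam (Suc l)) * lam (Suc l) = of_int p"
    using cop q k by auto
qed

text \<open>Both claims are proved in one induction, since \<open>k_num_props\<close> needs both of
  them at level \<open>l\<close> to reach level \<open>Suc l\<close>.\<close>

lemma e_num_pos_lattice: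
  "e_num lam l > 0 \<and> (\<forall>q. q \<in> lattice lam l \<longleftrightarrow> of_nat (e_num lam l) * q \<in> \<int>)"
proof (induction l)
  case (Suc l)
  let ?k = "k_num lam (Suc l)" and ?e = "e_num lam l"
  from Suc have e: "?e > 0" and lat: "\<And>q. q \<in> lattice lam l \<longleftrightarrow> of_nat ?e * q \<in> \<int>" by auto
  note k = k_num_props(1)[OF e lat]
  obtain p where cop: "coprime p (int ?k)" and p: "of_nat (e_num lam (Suc l)) * lam (Suc l) = of_int p"
    using k_num_props(2)[OF e lat] by blast
  have "q \<in> lattice lam (Suc l)" if "of_nat (e_num lam (Suc l)) * q \<in> \<int>" for q
  proof -
    from that obtain z where z: "of_nat (e_num lam (Suc l)) * q = of_int z" by (auto elim: Ints_cases)
    \<comment> \<open>By Bezout, removing \<open>z * u\<close> copies of \<open>lam (Suc l)\<close>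
      from \<open>q\<close> leaves an element whose product with \<open>?e\<close> is the integer
      \<open>z * v\<close>, so it lies in the previous lattice.\<close>
    obtain u v where uv: "u * p + v * int ?k = 1" using cop by (metis bezout_int coprime_imp_gcd_eq_1)
    have "of_nat (e_num lam (Suc l)) * (q - of_int (z * u) * lam (Suc l)) = of_int z * (1 - of_int (u * p))"
      using z p by (simp add: algebra_simps)
    also have "1 - u * p = v * int ?k" using uv by simp
    then have "of_int z * (1 - of_int (u * p)) = (of_int (z * v) * of_nat ?k :: rat)"
      by (metis (no_types, lifting) mult.assoc of_int_1 of_int_diff of_int_mult of_int_of_nat_eq)
    finally have "of_nat ?k * (of_nat ?e * (q - of_int (z * u) * lam (Suc l))) = of_nat ?k * of_int (z * v)"
      by (simp add: mult_ac)
    then have "of_nat ?e * (q - of_int (z * u) * lam (Suc l)) = of_int (z * v)" using k by simp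
    then have "q - of_int (z * u) * lam (Suc l) \<in> lattice lam l" by (metis lat Ints_of_int)
    moreover have "q = (q - of_int (z * u) * lam (Suc l)) + of_int (z * u) * lam (Suc l)" by simp
    ultimately show ?thesis unfolding lattice.simps by blast
  qed
  moreover have "of_nat (e_num lam (Suc l)) * q \<in> \<int>" if "q \<in> lattice lam (Suc l)" for q
  proof -
    from that obtain m n where q: "q = m + of_int n * lam (Suc l)" and m: "m \<in> lattice lam l" by auto
    have "of_nat (e_num lam (Suc l)) * q = of_nat ?k * (of_nat ?e * m) + of_int n * of_int p"
      using p unfolding q by (simp add: algebra_simps)
    also have "\<dots> \<in> \<int>" using m lat by auto
    finally show ?thesis .
  qed
  ultimately show ?case using k e by auto
qed simp

lemmas e_num_pos = e_num_pos_lattice[THEN conjunct1]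
lemmas lattice_iff = e_num_pos_lattice[THEN conjunct2, rule_format]

lemma e_num_dvd: "i \<le> j \<Longrightarrow> e_num lam i dvd e_num lam j"
  by (induction j rule: dec_induct) auto

text \<open>On the support of \<open>p\<close> the division by \<open>b\<close> is exact, so
  distinct exponents stay distinct and at most one term of the sum contributes to each
  coefficient.\<close>

lemma coeff_subst_frac:
  assumes "a > 0" and "b > 0" and "\<And>n. n \<in> poly_supp p \<Longrightarrow> b dvd n * a"
  shows "coeff (subst_frac a b p) m = (if a dvd m * b then coeff p (m * b div a) else 0)"
proof -
  have "coeff (subst_frac a b p) m = (\<Sum>n\<le>degree p. if n * a div b = m then coeff p n else 0)"
    by (simp add: subst_frac_def coeff_sum)
  also have "\<dots> = (\<Sum>n\<le>degree p. if a dvd m * b \<and> n = m * b div a then coeff p n else 0)"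
  proof (rule sum.cong[OF refl])
    fix n
    show "(if n * a div b = m then coeff p n else 0) =
          (if a dvd m * b \<and> n = m * b div a then coeff p n else 0)"
    proof (cases "coeff p n = 0")
      case False
      then have "b dvd n * a" using assms(3) by (simp add: poly_supp_def)
      then have "n * a div b = m \<longleftrightarrow> n * a = m * b" using assms(2) by auto
      also have "\<dots> \<longleftrightarrow> a dvd m * b \<and> n = m * b div a"
        using assms(1) by (metis dvd_div_mult_self dvd_triv_right nonzero_mult_div_cancel_right not_less0)
      finally show ?thesis by simp
    qed auto
  qed
  also have "\<dots> = (if a dvd m * b then coeff p (m * b div a) else 0)"
    by (cases "a dvd m * b") (simp_all add: coeff_eq_0 not_le)
  finally show ?thesis .
qed

lemma degree_subst_frac:
  assumes "a > 0" and "b > 0" and "\<And>n. n \<in> poly_supp p \<Longrightarrow> b dvd n * a"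
  shows "degree (subst_frac a b p) * b = degree p * a"
proof -
  \<comment> \<open>Replacing \<open>t\<close> by \<open>t ^ b\<close> clears the fractional
    exponents: both sides are \<open>p\<close> at \<open>t ^ a\<close>.\<close>
  have "pcompose (subst_frac a b p) (monom 1 b) = pcompose p (monom 1 a)"
  proof (rule poly_eqI)
    fix n
    have "coeff (subst_frac a b p) m = (if a dvd m * b then coeff p (m * b div a) else 0)" for m
      using assms by (rule coeff_subst_frac)
    then show "coeff (pcompose (subst_frac a b p) (monom 1 b)) n = coeff (pcompose p (monom 1 a)) n"
      using assms(1,2) assms(3)[of "n div a"]
      by (cases "coeff p (n div a) = 0") (auto simp: coeff_pcompose_monom poly_supp_def)
  qed
  then have "degree (pcompose (subst_frac a b p) (monom 1 b)) = degree (pcompose p (monom 1 a))"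
    by simp
  then show ?thesis by (simp add: degree_pcompose degree_monom_eq)
qed

lemma root_of_unity_coprime:
  fixes w :: "'a::monoid_mult"
  assumes "w ^ a = 1" and "w ^ k = 1" and "coprime a k" and "a > 0"
  shows "w = 1"
proof -
  obtain x y where "a * x = k * y + 1"
    using bezout_nat[of a k] assms(3,4) by auto
  then have "w ^ (a * x) = w * w ^ (k * y)" by simp
  with assms(1,2) show ?thesis by (simp add: power_mult)
qed

text \<open>The unrolled recursion is a count: the difference of the two quotients is the number of
  roots of unity \<open>z\<close> with \<open>z ^ (e_num lam i div e_num lam (l - 1)) = 1\<close>
  but \<open>z ^ (e_num lam i div e_num lam l) \<noteq> 1\<close>. The conjugates with such
  \<open>z\<close> will turn out to have contact order \<open>e_num lam j\<close> times
  \<open>lam l\<close>.\<close>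

lemma gamma_num_closed_form:
  "gamma_num lam j (Suc i) = of_nat (e_num lam j) * (lam (Suc i) +
     (\<Sum>l=1..i. (of_nat (e_num lam i div e_num lam (l - 1)) - of_nat (e_num lam i div e_num lam l)) * lam l))"
proof (induction i)
  case (Suc i)
  let ?E = "e_num lam" and ?k = "k_num lam (Suc i)"
  have div: "?E (Suc i) div ?E l = ?k * (?E i div ?E l)" if "l \<le> i" for l
    using e_num_dvd[OF that] by (simp add: div_mult_swap)
  let ?X = "\<lambda>j l. (of_nat (?E j div ?E (l - 1)) - of_nat (?E j div ?E l)) * lam l"
  have "(\<Sum>l=1..i. ?X (Suc i) l) = (\<Sum>l=1..i. of_nat ?k * ?X i l)"
    by (rule sum.cong) (auto simp: div algebra_simps simp del: e_num.simps)
  moreover have "?X (Suc i) (Suc i) = (of_nat ?k - 1) * lam (Suc i)"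
    using div[of i] e_num_pos[of lam i] e_num_pos[of lam "Suc i"] by (simp del: e_num.simps)
  ultimately have sum: "(\<Sum>l=1..Suc i. ?X (Suc i) l) =
      of_nat ?k * (\<Sum>l=1..i. ?X i l) + (of_nat ?k - 1) * lam (Suc i)"
    by (simp add: sum_distrib_left del: e_num.simps)
  show ?case
    unfolding gamma_num.simps Suc sum by (simp add: algebra_simps del: e_num.simps)
qed simp

lemma e_num_div_div:
  assumes "l \<le> i" and "i \<le> j"
  shows "e_num lam j div e_num lam l = (e_num lam j div e_num lam i) * (e_num lam i div e_num lam l)"
  using e_num_dvd[OF assms(1), of lam] e_num_dvd[OF assms(2), of lam]
  by (simp add: div_mult_swap)

section \<open>Contact orders of the conjugate parametrizations\<close>

lemma weierstrass_polyD:
  assumes "weierstrass_poly d f"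
  shows "degree f = d" and "coeff f d = 1"
  using assms by (auto simp: weierstrass_poly_def)

text \<open>Dividing exponents by \<open>e_num lam s\<close> lets all \<open>phi i\<close>,
  including the last one, be treated alike. The upper bound is conditional because
  \<open>phi s\<close> inherits its exponents from \<open>psi\<close>, which has no next
  characteristic exponent above it.\<close>

locale char_data =
  fixes s :: nat and lam :: "nat \<Rightarrow> rat" and c :: "nat \<Rightarrow> complex" and phi :: "nat \<Rightarrow> complex poly"
  assumes lam_mono: "strict_mono_on {1..s} lam"
    and lam_pos: "i \<in> {1..s} \<Longrightarrow> lam i > 0"
    and c_nonzero: "i \<in> {1..s} \<Longrightarrow> c i \<noteq> 0"
    and phi_supp: "i \<in> {1..s} \<Longrightarrow> n \<in> poly_supp (phi i) \<Longrightarrow>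
      \<exists>q\<in>lattice lam i. of_nat n = of_nat (e_num lam s) * q \<and> lam i < q \<and> (i < s \<longrightarrow> q < lam (Suc i))"
begin

abbreviation E :: "nat \<Rightarrow> nat" where "E \<equiv> e_num lam"

lemma lam_less: "l \<in> {1..s} \<Longrightarrow> m \<in> {1..s} \<Longrightarrow> l < m \<Longrightarrow> lam l < lam m"
  using lam_mono by (auto simp: strict_mono_on_def)

lemma E_nz [simp]: "E i \<noteq> 0" and E_pos [simp]: "E i > 0"
  using e_num_pos[of lam i] by auto

lemma E_eq: "l \<le> i \<Longrightarrow> E i = E l * (E i div E l)"
  using e_num_dvd[of l i lam] by simp

lemma E_div_pos: "l \<le> i \<Longrightarrow> E i div E l > 0"
  using e_num_dvd[of l i lam] by (auto simp: div_greater_zero_iff intro: dvd_imp_le)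

text \<open>The characteristic exponent is taken at its own level because it is there that it is
  coprime to \<open>k_num lam l\<close>; passing to level \<open>i\<close> multiplies it by
  \<open>E i div E l\<close>.\<close>

definition lead_exp :: "nat \<Rightarrow> nat" where "lead_exp l = char_exp lam l l"

lemma lead_exp_props:
  assumes "l \<in> {1..s}"
  shows "of_nat (lead_exp l) = of_nat (E l) * lam l"
    and "lead_exp l > 0"
    and "coprime (lead_exp l) (k_num lam l)"
proof -
  obtain m where l: "l = Suc m" using assms by (cases l) auto
  obtain p where cop: "coprime p (int (k_num lam l))" and p: "of_nat (E l) * lam l = of_int p"
    using k_num_props(2)[OF e_num_pos lattice_iff, of lam m] unfolding l by blast
  have "of_nat (E l) * lam l > 0" using lam_pos[OF assms] by simp
  with p have pos: "p > 0" by simp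
  have eq: "lead_exp l = nat p" unfolding lead_exp_def char_exp_def p by simp
  then show "of_nat (lead_exp l) = of_nat (E l) * lam l" "lead_exp l > 0"
    using p pos by auto
  have "int (lead_exp l) = p" using eq pos by simp
  then show "coprime (lead_exp l) (k_num lam l)"
    using cop by (metis coprime_int_iff)
qed

lemma char_exp_eq:
  assumes "l \<in> {1..s}" and "l \<le> i"
  shows "char_exp lam i l = lead_exp l * (E i div E l)"
proof -
  have "of_nat (E i) * lam l = of_nat (E l) * lam l * of_nat (E i div E l)"
    using E_eq[OF assms(2)] by (metis mult.assoc mult.commute of_nat_mult)
  also have "\<dots> = of_nat (lead_exp l * (E i div E l))"
    using lead_exp_props(1)[OF assms(1)] by simp
  finally show ?thesis unfolding char_exp_def by (simp only: floor_of_nat nat_int)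
qed

text \<open>An exponent of \<open>phi l\<close> is \<open>E s\<close> times an element of
  \<open>lattice lam l\<close>, whose denominator divides \<open>E l\<close> and therefore
  \<open>E i\<close>.\<close>

lemma phi_supp_dvd:
  assumes "l \<in> {1..s}" and "l \<le> i" and "n \<in> poly_supp (phi l)"
  shows "E s dvd n * E i"
proof -
  obtain q where q: "q \<in> lattice lam l" "of_nat n = of_nat (E s) * q"
    using phi_supp[OF assms(1,3)] by blast
  then obtain z where z: "of_nat (E l) * q = of_int z" by (auto simp: lattice_iff elim: Ints_cases)
  have "(of_int (int (n * E l)) :: rat) = of_nat (E s) * (of_nat (E l) * q)" using q by simp
  also have "\<dots> = of_int (int (E s) * z)" by (simp add: z)
  finally have "int (n * E l) = int (E s) * z" by (simp only: of_int_eq_iff)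
  then have "E s dvd n * E l" by (metis dvd_triv_left int_dvd_int_iff)
  then show ?thesis using e_num_dvd[OF assms(2), of lam] by (meson dvd_trans mult_dvd_mono dvd_refl)
qed

lemma coeff_subst_frac_phi:
  assumes "l \<in> {1..s}" and "l \<le> i"
  shows "coeff (subst_frac (E i) (E s) (phi l)) m =
    (if E i dvd m * E s then coeff (phi l) (m * E s div E i) else 0)"
  using assms by (intro coeff_subst_frac E_pos phi_supp_dvd)

text \<open>The part of the parametrization that enters at level \<open>l\<close>, written in the
  parameter of that level; \<open>branch_eq\<close> shows that later levels only rescale it.\<close>

definition block :: "nat \<Rightarrow> complex poly" where
  "block l = monom (c l) (lead_exp l) + subst_frac (E l) (E s) (phi l)"

lemma subst_frac_rescale:
  assumes "l \<in> {1..s}" and "l \<le> i"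
  shows "subst_frac (E i) (E s) (phi l) = pcompose (subst_frac (E l) (E s) (phi l)) (monom 1 (E i div E l))"
proof (rule poly_eqI)
  fix n
  note coeff_i = coeff_subst_frac_phi[OF assms]
    and coeff_l = coeff_subst_frac_phi[OF assms(1) order_refl]
  obtain d where d: "E i div E l = d" "d > 0" "E i = d * E l"
    using E_div_pos[OF assms(2)] E_eq[OF assms(2)] by (metis mult.commute)
  show "coeff (subst_frac (E i) (E s) (phi l)) n =
      coeff (pcompose (subst_frac (E l) (E s) (phi l)) (monom 1 (E i div E l))) n"
    unfolding d(1)
  proof (cases "d dvd n")
    case True
    then obtain m where n: "n = d * m" by blast
    have "n * E s = d * (m * E s)" by (simp add: n)
    then have "E i dvd n * E s \<longleftrightarrow> E l dvd m * E s" "n * E s div E i = m * E s div E l"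
      unfolding d(3) using d(2) by simp_all
    then show "coeff (subst_frac (E i) (E s) (phi l)) n =
        coeff (pcompose (subst_frac (E l) (E s) (phi l)) (monom 1 d)) n"
      using d(2) n by (simp add: coeff_pcompose_monom coeff_i coeff_l)
  next
    case False
    \<comment> \<open>An exponent of \<open>phi l\<close> already becomes integral at level
      \<open>l\<close>, so at level \<open>i\<close> it is a multiple of \<open>d\<close>; other
      \<open>n\<close> receive no coefficient.\<close>
    have "coeff (phi l) (n * E s div E i) = 0" if "E i dvd n * E s"
    proof (rule ccontr)
      assume "coeff (phi l) (n * E s div E i) \<noteq> 0"
      then have "E s dvd (n * E s div E i) * E l"
        using phi_supp_dvd[OF assms(1) order_refl] by (simp add: poly_supp_def)
      then obtain w where "(n * E s div E i) * E l = E s * w" by blast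
      then have "(n * E s div E i) * E i = w * d * E s"
        using d(3) by (simp add: mult.assoc mult.left_commute)
      then have "n = w * d" using that by simp
      with False show False by simp
    qed
    then show "coeff (subst_frac (E i) (E s) (phi l)) n =
        coeff (pcompose (subst_frac (E l) (E s) (phi l)) (monom 1 d)) n"
      using d(2) False by (simp add: coeff_pcompose_monom coeff_i)
  qed
qed

definition branch :: "nat \<Rightarrow> complex poly" where
  "branch i = snd (iota_trunc s lam c phi i)"

lemma iota_trunc_eq: "iota_trunc s lam c phi i = (monom 1 (E i), branch i)"
  by (simp add: branch_def iota_trunc_def)

lemma branch_eq:
  assumes "i \<le> s"
  shows "branch i = (\<Sum>l=1..i. pcompose (block l) (monom 1 (E i div E l)))"
  unfolding branch_def iota_trunc_def snd_conv
proof (rule sum.cong[OF refl])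
  fix l assume "l \<in> {1..i}"
  with assms have l: "l \<in> {1..s}" "l \<le> i" by auto
  show "monom (c l) (char_exp lam i l) + subst_frac (E i) (E s) (phi l) =
      pcompose (block l) (monom 1 (E i div E l))"
    by (simp add: block_def pcompose_add pcompose_monom_monom char_exp_eq[OF l] subst_frac_rescale[OF l]
        mult.commute)
qed

text \<open>All exponents of the rescaled \<open>phi l\<close> exceed \<open>lead_exp l\<close>, so
  only the characteristic monomial is visible in this range.\<close>

lemma coeff_block_low:
  assumes l: "l \<in> {1..s}" and n: "n \<le> lead_exp l"
  shows "coeff (block l) n = (if n = lead_exp l then c l else 0)"
proof -
  have "coeff (subst_frac (E l) (E s) (phi l)) n = 0"
  proof (rule ccontr)
    assume "coeff (subst_frac (E l) (E s) (phi l)) n \<noteq> 0"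
    then have dvd: "E l dvd n * E s" and N: "n * E s div E l \<in> poly_supp (phi l)"
      by (auto simp: coeff_subst_frac_phi[OF l order_refl] poly_supp_def
          split: if_splits)
    from phi_supp[OF l N] obtain q where q: "of_nat (n * E s div E l) = of_nat (E s) * q" "lam l < q"
      by blast
    have "of_nat n * of_nat (E s) = (of_nat (n * E s div E l * E l) :: rat)"
      using dvd by (simp del: of_nat_mult add: of_nat_mult[symmetric])
    also have "\<dots> = of_nat (E s) * (of_nat (E l) * q)" using q by simp
    finally have "of_nat n = of_nat (E l) * q" by simp
    also have "\<dots> > of_nat (E l) * lam l" using q by simp
    finally have "of_nat n > (of_nat (lead_exp l) :: rat)" using lead_exp_props(1)[OF l] by simp
    with n show False by simp
  qed
  then show ?thesis by (simp add: block_def)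
qed

definition factor :: "nat \<Rightarrow> nat \<Rightarrow> complex \<Rightarrow> complex poly" where
  "factor i j z = branch j - pcompose (branch i) (monom z (E j div E i))"

lemma coeff_pcompose_block:
  assumes "l \<in> {1..s}" and "d > 0" and "n \<le> lead_exp l * d"
  shows "coeff (pcompose (block l) (monom z d)) n =
    (if n = lead_exp l * d then z ^ lead_exp l * c l else 0)"
proof (cases "d dvd n")
  case True
  then obtain m where m: "n = d * m" by blast
  with assms(2,3) have "m \<le> lead_exp l" by (simp add: mult.commute)
  with assms m show ?thesis by (simp add: coeff_pcompose_monom coeff_block_low mult.commute)
next
  case False
  with assms show ?thesis by (auto simp: coeff_pcompose_monom)
qed

text \<open>The two branches are compared block by block, block \<open>m\<close> of the conjugate
  being twisted by \<open>w m = z ^ (E i div E m)\<close>. For \<open>m < l\<close> the twist is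
  trivial and the blocks cancel; for \<open>m > l\<close> they start beyond \<open>n\<close>. Only
  block \<open>l\<close> remains.\<close>

lemma coeff_factor:
  assumes "i \<le> j" and "j \<le> s" and "l \<in> {1..Suc i}" and "l \<le> j"
    and z: "z ^ (E i div E (l - 1)) = 1"
    and n: "n \<le> lead_exp l * (E j div E l)"
  shows "coeff (factor i j z) n = (if n = lead_exp l * (E j div E l)
    then (if l \<le> i then 1 - (z ^ (E i div E l)) ^ lead_exp l else 1) * c l else 0)"
proof -
  define D where "D m = E j div E m" for m
  define w where "w m = z ^ (E i div E m)" for m
  have l: "l \<in> {1..s}" using assms by auto
  \<comment> \<open>The truncation at \<open>i\<close> has no blocks above \<open>i\<close>, so
    there is nothing to subtract for \<open>m > i\<close>; this covers
    \<open>l = Suc i\<close>.\<close>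
  define G where "G m = pcompose (block m) (monom 1 (D m)) -
    (if m \<le> i then pcompose (block m) (monom (w m) (D m)) else 0)" for m
  have "pcompose (branch i) (monom z (E j div E i)) =
      (\<Sum>m=1..i. pcompose (pcompose (block m) (monom 1 (E i div E m))) (monom z (E j div E i)))"
    using assms(1,2) by (simp add: branch_eq pcompose_sum)
  also have "\<dots> = (\<Sum>m=1..i. pcompose (block m) (monom (w m) (D m)))"
  proof (rule sum.cong[OF refl])
    fix m assume "m \<in> {1..i}"
    then have "D m = (E j div E i) * (E i div E m)"
      using assms(1) e_num_div_div[of m i j lam] by (simp add: D_def)
    then show "pcompose (pcompose (block m) (monom 1 (E i div E m))) (monom z (E j div E i)) =
        pcompose (block m) (monom (w m) (D m))"
      by (simp add: pcompose_assoc[symmetric] pcompose_monom_monom w_def)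
  qed
  also have "\<dots> = (\<Sum>m=1..j. if m \<le> i then pcompose (block m) (monom (w m) (D m)) else 0)"
    using assms(1) by (intro sum.mono_neutral_cong_left) auto
  finally have factor: "factor i j z = (\<Sum>m=1..j. G m)"
    using assms(2) by (simp add: factor_def G_def branch_eq D_def sum_subtractf)
  have "coeff (G m) n = 0" if m: "m \<in> {1..j} - {l}" for m
  proof (cases "m < l")
    case True
    then have "m \<le> l - 1" "l - 1 \<le> i" "m \<le> i" using assms(3) by auto
    then have "w m = 1"
      using z e_num_div_div[of m "l - 1" i lam] by (simp add: w_def power_mult)
    then show ?thesis using \<open>m \<le> i\<close> by (simp add: G_def)
  next
    case False
    with m have ml: "l < m" "m \<in> {1..s}" "m \<le> j" using assms(2) by auto
    have *: "of_nat (lead_exp k * D k) = of_nat (E j) * lam k" if "k \<in> {1..s}" "k \<le> j" for k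
    proof -
      have "of_nat (lead_exp k * D k) = of_nat (E k) * lam k * of_nat (D k)"
        using lead_exp_props(1)[OF that(1)] by simp
      also have "\<dots> = of_nat (E k * D k) * lam k" by simp
      finally show ?thesis using E_eq[OF that(2)] by (simp add: D_def)
    qed
    have "of_nat (lead_exp l * D l) < (of_nat (lead_exp m * D m) :: rat)"
      using *[of l] *[of m] l ml assms(4) lam_less[of l m] by simp
    then have "n < lead_exp m * D m" using n unfolding D_def by (simp only: of_nat_less_iff)
    then show ?thesis using ml E_div_pos[of m j] by (simp add: G_def coeff_pcompose_block D_def)
  qed
  then have "(\<Sum>m\<in>{1..j} - {l}. coeff (G m) n) = 0" by (intro sum.neutral) auto
  then have "coeff (factor i j z) n = coeff (G l) n"
    using assms(3,4) by (simp add: factor coeff_sum sum.remove[of _ l])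
  also have "\<dots> = (if n = lead_exp l * D l then (if l \<le> i then 1 - w l ^ lead_exp l else 1) * c l else 0)"
    using n l E_div_pos[OF assms(4)] by (simp add: G_def coeff_pcompose_block D_def algebra_simps)
  finally show ?thesis by (simp add: D_def w_def)
qed

text \<open>The coefficient at the expected order could vanish only if
  \<open>z ^ (E i div E l)\<close> were killed by the exponent \<open>lead_exp l\<close>. It is also
  killed by \<open>k_num lam l\<close>, and as these are coprime it would be 1, against the choice
  of \<open>l\<close>.\<close>

lemma factor_order:
  assumes "i \<le> j" and "j \<le> s" and "l \<in> {1..Suc i}" and "l \<le> j"
    and z: "z ^ (E i div E (l - 1)) = 1" and nz: "l \<le> i \<Longrightarrow> z ^ (E i div E l) \<noteq> 1"
  shows "factor i j z \<noteq> 0"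
    and "of_nat (subdegree (fps_of_poly (factor i j z))) = of_nat (E j) * lam l"
proof -
  let ?N = "lead_exp l * (E j div E l)"
  have l: "l \<in> {1..s}" using assms by auto
  have "(z ^ (E i div E l)) ^ lead_exp l \<noteq> 1" if "l \<le> i"
  proof
    assume *: "(z ^ (E i div E l)) ^ lead_exp l = 1"
    have "E l = k_num lam l * E (l - 1)" using assms(3) by (cases l) auto
    then have "E i div E (l - 1) = E i div E l * k_num lam l"
      using e_num_div_div[of "l - 1" l i lam] that by simp
    then have "(z ^ (E i div E l)) ^ k_num lam l = 1" using z by (simp add: power_mult)
    from root_of_unity_coprime[OF * this lead_exp_props(3,2)[OF l]] nz[OF that] show False by simp
  qed
  then have N: "coeff (factor i j z) ?N \<noteq> 0"
    using coeff_factor[OF assms(1-5) order_refl] c_nonzero[OF l] by auto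
  then show "factor i j z \<noteq> 0" by auto
  have "subdegree (fps_of_poly (factor i j z)) = ?N"
    using N coeff_factor[OF assms(1-5)] by (intro subdegreeI) auto
  then have "of_nat (subdegree (fps_of_poly (factor i j z))) = of_nat (E l) * lam l * of_nat (E j div E l)"
    using lead_exp_props(1)[OF l] by simp
  also have "\<dots> = of_nat (E l * (E j div E l)) * lam l" by simp
  finally show "of_nat (subdegree (fps_of_poly (factor i j z))) = of_nat (E j) * lam l"
    using E_eq[OF assms(4)] by simp
qed

section \<open>The chain of groups of roots of unity and the total contact order\<close>

definition unity_roots :: "nat \<Rightarrow> nat \<Rightarrow> complex set" where
  "unity_roots i m = {z. z ^ (E i div E m) = 1}"

lemma unity_roots_0: "unity_roots i 0 = {z. z ^ E i = 1}" and unity_roots_self: "unity_roots i i = {1}"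
  by (auto simp: unity_roots_def)

lemma finite_unity_roots: "m \<le> i \<Longrightarrow> finite (unity_roots i m)"
  and card_unity_roots: "m \<le> i \<Longrightarrow> card (unity_roots i m) = E i div E m"
  using E_div_pos[of m i] unfolding unity_roots_def
  by (auto intro!: finite_roots_unity card_roots_unity_eq)

lemma unity_roots_mono: "m \<le> n \<Longrightarrow> n \<le> i \<Longrightarrow> unity_roots i n \<subseteq> unity_roots i m"
  unfolding unity_roots_def using e_num_div_div[of m n i lam] by (auto simp: power_mult)

text \<open>The groups shrink from all \<open>E i\<close>-th roots of unity to the trivial group, so
  \<open>z\<close> drops out at some first index.\<close>

lemma unity_roots_level:
  assumes "z \<in> unity_roots i 0" and "z \<noteq> 1"
  obtains l where "l \<in> {1..i}" and "z \<in> unity_roots i (l - 1)" and "z \<notin> unity_roots i l"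
proof -
  define l where "l = (LEAST l. z \<notin> unity_roots i l)"
  have i: "z \<notin> unity_roots i i" using assms(2) by (simp add: unity_roots_self)
  then have 1: "z \<notin> unity_roots i l" unfolding l_def by (rule LeastI)
  moreover have "l \<le> i" unfolding l_def using i by (rule Least_le)
  moreover have "l \<noteq> 0" using 1 assms(1) by metis
  moreover then have "z \<in> unity_roots i (l - 1)" unfolding l_def
    using not_less_Least[of "l - 1" "\<lambda>l. z \<notin> unity_roots i l"] unfolding l_def by auto
  ultimately show thesis by (intro that[of l]) auto
qed

lemma factor_order_unity_roots:
  assumes "i \<le> j" and "j \<le> s" and "l \<in> {1..i}" and "z \<in> unity_roots i (l - 1)" and "z \<notin> unity_roots i l"
  shows "factor i j z \<noteq> 0"
    and "of_nat (subdegree (fps_of_poly (factor i j z))) = of_nat (E j) * lam l"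
  using factor_order[OF assms(1,2), of l z] assms by (auto simp: unity_roots_def)

text \<open>Since 1 lies in every group of the chain, all common blocks cancel and the first new
  block of \<open>branch j\<close> decides; it exists because \<open>i < j\<close>.\<close>

lemma factor_order_1:
  assumes "i < j" and "j \<le> s"
  shows "factor i j 1 \<noteq> 0"
    and "of_nat (subdegree (fps_of_poly (factor i j 1))) = of_nat (E j) * lam (Suc i)"
  using factor_order[of i j "Suc i" 1] assms by auto

lemma factor_nonzero:
  assumes "i < j" and "j \<le> s" and "z \<in> unity_roots i 0"
  shows "factor i j z \<noteq> 0"
  by (metis unity_roots_level assms factor_order_unity_roots(1) factor_order_1(1) less_imp_le)

lemma factor_subdegree_less:
  assumes "i < j" and "j \<le> s" and "z \<in> unity_roots i 0" and "z \<noteq> 1"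
  shows "subdegree (fps_of_poly (factor i j z)) < subdegree (fps_of_poly (factor i j 1))"
proof -
  obtain l where l: "l \<in> {1..i}" "z \<in> unity_roots i (l - 1)" "z \<notin> unity_roots i l"
    using unity_roots_level[OF assms(3,4)] .
  have "(of_nat (subdegree (fps_of_poly (factor i j z))) :: rat) < of_nat (subdegree (fps_of_poly (factor i j 1)))"
    using assms l lam_less[of l "Suc i"]
    by (simp add: factor_order_unity_roots(2)[OF _ _ l] factor_order_1(2))
  then show ?thesis by simp
qed

text \<open>Downward induction along the chain: at \<open>m = i\<close> only \<open>z = 1\<close> is
  left, and each step adds the layer between two successive groups, on which the order is
  constant.\<close>

lemma sum_factor_order:
  assumes "i < j" and "j \<le> s" and "m \<le> i"
  shows "(\<Sum>z\<in>unity_roots i m. of_nat (subdegree (fps_of_poly (factor i j z)))) =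
    of_nat (E j) * (lam (Suc i) +
      (\<Sum>l=Suc m..i. (of_nat (E i div E (l - 1)) - of_nat (E i div E l)) * lam l))"
  using assms(3)
proof (induction m rule: inc_induct)
  case base
  show ?case using factor_order_1(2)[OF assms(1,2)] by (simp add: unity_roots_self)
next
  case (step m)
  have sub: "unity_roots i (Suc m) \<subseteq> unity_roots i m" using step by (intro unity_roots_mono) auto
  have fin: "finite (unity_roots i m)" using step by (intro finite_unity_roots) auto
  have "of_nat (subdegree (fps_of_poly (factor i j z))) = of_nat (E j) * lam (Suc m)"
    if "z \<in> unity_roots i m - unity_roots i (Suc m)" for z
    using that assms step by (intro factor_order_unity_roots) auto
  then have "(\<Sum>z\<in>unity_roots i m - unity_roots i (Suc m). of_nat (subdegree (fps_of_poly (factor i j z)))) =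
      of_nat (card (unity_roots i m - unity_roots i (Suc m))) * (of_nat (E j) * lam (Suc m))"
    by simp
  also have "of_nat (card (unity_roots i m - unity_roots i (Suc m))) = (of_nat (E i div E m) - of_nat (E i div E (Suc m)) :: rat)"
    using sub fin step card_mono[OF fin sub]
    by (simp add: card_Diff_subset finite_subset card_unity_roots of_nat_diff del: e_num.simps)
  finally have "(\<Sum>z\<in>unity_roots i m. of_nat (subdegree (fps_of_poly (factor i j z)))) =
     (of_nat (E i div E m) - of_nat (E i div E (Suc m))) * (of_nat (E j) * lam (Suc m)) +
     (\<Sum>z\<in>unity_roots i (Suc m). of_nat (subdegree (fps_of_poly (factor i j z))))"
    using sum.subset_diff[OF sub fin] by metis
  then show ?case
    using step by (simp add: sum.atLeast_Suc_atMost[of "Suc m" i] algebra_simps del: e_num.simps)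
qed

lemma prod_factor_order:
  assumes "i < j" and "j \<le> s"
  shows "of_nat (subdegree (\<Prod>z\<in>unity_roots i 0. fps_of_poly (factor i j z))) = gamma_num lam j (Suc i)"
proof -
  have "subdegree (\<Prod>z\<in>unity_roots i 0. fps_of_poly (factor i j z)) =
      (\<Sum>z\<in>unity_roots i 0. subdegree (fps_of_poly (factor i j z)))"
    using factor_nonzero[OF assms] by (intro subdegree_prod) auto
  then show ?thesis
    using sum_factor_order[OF assms, of 0] by (simp add: gamma_num_closed_form)
qed

section \<open>Factorization over the parameter ring and the valuations\<close>

abbreviation base_change :: "nat \<Rightarrow> complex poly poly \<Rightarrow> complex poly poly" where
  "base_change j \<equiv> map_poly (\<lambda>a. pcompose a (monom 1 (E j)))"

abbreviation conj_root :: "nat \<Rightarrow> nat \<Rightarrow> complex \<Rightarrow> complex poly" where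
  "conj_root i j z \<equiv> pcompose (branch i) (monom z (E j div E i))"

lemma pullback_eq: "pullback (iota_trunc s lam c phi j) g = poly (base_change j g) (branch j)"
  by (simp add: pullback_def iota_trunc_eq)

text \<open>Replace \<open>t\<close> by \<open>z * t ^ (E j div E i)\<close> in the vanishing
  pullback; as \<open>z ^ E i = 1\<close>, the first coordinate becomes \<open>t ^ E j\<close>,
  independent of \<open>z\<close>.\<close>

lemma base_change_conj_root:
  assumes "i \<le> j" and "pullback (iota_trunc s lam c phi i) g = 0" and "z \<in> unity_roots i 0"
  shows "poly (base_change j g) (conj_root i j z) = 0"
proof -
  have "0 = pcompose (poly (base_change i g) (branch i)) (monom z (E j div E i))"
    using assms(2) by (simp add: pullback_eq)
  also have "\<dots> = poly (map_poly (\<lambda>a. pcompose a (pcompose (monom 1 (E i)) (monom z (E j div E i)))) g)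
      (conj_root i j z)"
    by (rule pcompose_poly_map_poly_pcompose)
  also have "pcompose (monom 1 (E i)) (monom z (E j div E i)) = monom 1 (E j)"
    using assms(1,3) E_eq[of i j] by (simp add: pcompose_monom_monom unity_roots_0 mult.commute)
  finally show ?thesis by simp
qed

text \<open>If two conjugates agree, comparing coefficients shows that \<open>branch i\<close> is
  invariant under scaling \<open>t\<close> by \<open>z / z'\<close>. Then
  \<open>factor i i (z / z')\<close> is zero, which \<open>factor_order_unity_roots\<close> excludes
  unless the ratio is 1.\<close>

lemma inj_on_conj_root:
  assumes "i \<le> j" and "j \<le> s"
  shows "inj_on (conj_root i j) (unity_roots i 0)"
proof (rule inj_onI)
  fix z z' assume z: "z \<in> unity_roots i 0" "z' \<in> unity_roots i 0" and eq: "conj_root i j z = conj_root i j z'"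
  have z'0: "z' \<noteq> 0" using z(2) by (auto simp: unity_roots_0 power_0_left)
  have "coeff (branch i) n = (z / z') ^ n * coeff (branch i) n" for n
  proof -
    have "coeff (conj_root i j z) ((E j div E i) * n) = coeff (conj_root i j z') ((E j div E i) * n)"
      by (simp add: eq)
    then show ?thesis using z'0 E_div_pos[OF assms(1)]
      by (auto simp: coeff_pcompose_monom power_divide field_simps)
  qed
  then have "factor i i (z / z') = 0"
    by (intro poly_eqI) (simp add: factor_def coeff_pcompose_monom)
  moreover have "z / z' \<in> unity_roots i 0" using z by (simp add: unity_roots_0 power_divide)
  ultimately have "z / z' = 1" using unity_roots_level[of "z / z'" i] factor_order_unity_roots(1)[of i i _ "z / z'"] assms
    by (metis order.trans order_refl)
  then show "z = z'" using z'0 by simp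
qed

lemma base_change_eq_prod:
  assumes "i \<le> j" and "j \<le> s" and "pullback (iota_trunc s lam c phi i) g = 0"
    and "weierstrass_poly (E i) g"
  shows "base_change j g = (\<Prod>z\<in>unity_roots i 0. [:- conj_root i j z, 1:])"
proof (rule monic_eq_prod_roots)
  show "degree (base_change j g) = card (unity_roots i 0)"
    by (simp add: degree_map_poly_pcompose_monom weierstrass_polyD[OF assms(4)] card_unity_roots)
  show "lead_coeff (base_change j g) = 1"
    by (simp add: degree_map_poly_pcompose_monom coeff_map_poly weierstrass_polyD[OF assms(4)] pcompose_1)
qed (use assms in \<open>auto intro: finite_unity_roots inj_on_conj_root base_change_conj_root\<close>)

lemma theta_eq:
  assumes "fps_of_poly (pullback (iota_trunc s lam c phi j) g) = F" and "F \<noteq> 0"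
    and "of_nat (subdegree F) = q"
  shows "ereal_of_enat (theta (iota_trunc s lam c phi j) g) = ereal (of_rat q)"
  using assms by (auto simp: theta_def ord_t_def)

lemma theta_truncation:
  assumes "i < j" and "j \<le> s" and "pullback (iota_trunc s lam c phi i) g = 0"
    and "weierstrass_poly (E i) g"
  shows "ereal_of_enat (theta (iota_trunc s lam c phi j) g) = ereal (of_rat (gamma_num lam j (Suc i)))"
proof (rule theta_eq)
  show "fps_of_poly (pullback (iota_trunc s lam c phi j) g) = (\<Prod>z\<in>unity_roots i 0. fps_of_poly (factor i j z))"
    using assms by (simp add: pullback_eq base_change_eq_prod[of i j g] poly_prod fps_of_poly_prod factor_def)
  show "(\<Prod>z\<in>unity_roots i 0. fps_of_poly (factor i j z)) \<noteq> 0"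
    using factor_nonzero[OF assms(1,2)] finite_unity_roots[of 0 i] by (simp add: prod_zero_iff)
  show "of_nat (subdegree (\<Prod>z\<in>unity_roots i 0. fps_of_poly (factor i j z))) = gamma_num lam j (Suc i)"
    by (rule prod_factor_order[OF assms(1,2)])
qed

lemma theta_pderiv_truncation:
  assumes "i < j" and "j \<le> s" and "pullback (iota_trunc s lam c phi i) g = 0"
    and "weierstrass_poly (E i) g"
  shows "ereal_of_enat (theta (iota_trunc s lam c phi j) (pderiv g)) =
    ereal (of_rat (gamma_num lam j (Suc i) - of_nat (E j) * lam (Suc i)))"
proof (rule theta_eq)
  define u where "u z = fps_of_poly (factor i j z)" for z
  define v where "v z = prod u (unity_roots i 0 - {z})" for z
  have fin: "finite (unity_roots i 0)" by (simp add: finite_unity_roots)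
  have u: "u z \<noteq> 0" if "z \<in> unity_roots i 0" for z
    using factor_nonzero[OF assms(1,2) that] by (simp add: u_def)
  have v: "v z \<noteq> 0" if "z \<in> unity_roots i 0" for z
    using u fin by (simp add: v_def prod_zero_iff)
  \<comment> \<open>The two orders have a sum independent of \<open>z\<close>, so the factor of
    largest order, at \<open>z = 1\<close>, leaves the cofactor of smallest order.\<close>
  have uv: "subdegree (u z) + subdegree (v z) = subdegree (prod u (unity_roots i 0))" if "z \<in> unity_roots i 0" for z
  proof -
    have "prod u (unity_roots i 0) = u z * v z" using fin that by (simp add: v_def prod.remove)
    then show ?thesis using u[OF that] v[OF that] by simp
  qed
  have 1: "1 \<in> unity_roots i 0" by (simp add: unity_roots_0)
  have less: "subdegree (v 1) < subdegree (v z)" if "z \<in> unity_roots i 0 - {1}" for z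
    using that uv[of z] uv[OF 1] factor_subdegree_less[OF assms(1,2), of z] by (simp add: u_def)
  have dom: "sum v (unity_roots i 0) \<noteq> 0"
    "subdegree (sum v (unity_roots i 0)) = subdegree (v 1)"
    using fps_sum_dominant[where g = v and A = "unity_roots i 0" and b = 1] fin 1 v[OF 1] less
    by blast+
  \<comment> \<open>Product rule: each linear factor has derivative 1, so the derivative is the sum
    of the cofactors \<open>v z\<close>.\<close>
  show "fps_of_poly (pullback (iota_trunc s lam c phi j) (pderiv g)) = sum v (unity_roots i 0)"
    using assms
    by (simp add: pullback_eq pderiv_map_poly_pcompose[symmetric] base_change_eq_prod[of i j g] pderiv_prod
        poly_sum poly_prod fps_of_poly_sum fps_of_poly_prod v_def u_def factor_def pderiv_pCons)
  show "sum v (unity_roots i 0) \<noteq> 0" by (rule dom(1))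
  have "of_nat (subdegree (u 1)) + of_nat (subdegree (v 1)) = (of_nat (subdegree (prod u (unity_roots i 0))) :: rat)"
    using uv[OF 1] by (metis of_nat_add)
  then have "of_nat (subdegree (v 1)) = gamma_num lam j (Suc i) - of_nat (subdegree (u 1))"
    using prod_factor_order[OF assms(1,2)] by (simp add: u_def)
  then show "of_nat (subdegree (sum v (unity_roots i 0))) = gamma_num lam j (Suc i) - of_nat (E j) * lam (Suc i)"
    using factor_order_1(2)[OF assms(1,2)] by (simp add: dom(2) u_def)
qed

lemma pullback_eq_0_imp_eq_0:
  assumes "i \<le> s" and "degree g < E i" and "pullback (iota_trunc s lam c phi i) g = 0"
  shows "g = 0"
proof -
  have "base_change i g = 0"
  proof (rule poly_eq_0_of_card_roots)
    show "inj_on (conj_root i i) (unity_roots i 0)" using assms(1) by (intro inj_on_conj_root) auto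
    show "degree (base_change i g) < card (unity_roots i 0)"
      using assms(2) by (simp add: degree_map_poly_pcompose_monom card_unity_roots)
    show "poly (base_change i g) (conj_root i i z) = 0" if "z \<in> unity_roots i 0" for z
      using that assms(3) by (intro base_change_conj_root) auto
  qed
  then have "coeff (base_change i g) n = 0" for n by simp
  then show ?thesis
    by (intro poly_eqI) (simp add: coeff_map_poly pcompose_monom_eq_0_iff)
qed

lemma pullback_diff_smult:
  "pullback (iota_trunc s lam c phi i) (g - smult [:a:] h) =
     pullback (iota_trunc s lam c phi i) g - smult a (pullback (iota_trunc s lam c phi i) h)"
proof -
  have "base_change i (g - smult [:a:] h) = base_change i g - smult [:a:] (base_change i h)"
    by (intro poly_eqI) (simp add: coeff_map_poly pcompose_diff pcompose_mult pcompose_smult)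
  then show ?thesis by (simp add: pullback_eq)
qed

text \<open>Unless \<open>phi i\<close> is zero, \<open>mu_num\<close> is its top exponent divided
  by \<open>E s\<close>, so the support condition applies. Both bounds together order the slopes of
  successive Newton regions.\<close>

lemma mu_num_bounds:
  assumes "i \<in> {1..s}"
  shows "lam i \<le> mu_num s lam phi i" and "i < s \<Longrightarrow> mu_num s lam phi i < lam (Suc i)"
proof -
  have "lam i \<le> mu_num s lam phi i \<and> (i < s \<longrightarrow> mu_num s lam phi i < lam (Suc i))"
  proof (cases "phi i = 0")
    case True
    then show ?thesis using assms lam_less[of i "Suc i"] by (simp add: mu_num_def)
  next
    case False
    let ?d = "degree (subst_frac (E i) (E s) (phi i))"
    have "degree (phi i) \<in> poly_supp (phi i)" using False by (simp add: poly_supp_def)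
    from phi_supp[OF assms this] obtain q where
      q: "of_nat (degree (phi i)) = of_nat (E s) * q" "lam i < q" "i < s \<longrightarrow> q < lam (Suc i)" by blast
    have "of_nat ?d * of_nat (E s) = (of_nat (degree (phi i)) * of_nat (E i) :: rat)"
      using degree_subst_frac[of "E i" "E s" "phi i"] phi_supp_dvd[OF assms order_refl]
      by (metis E_pos of_nat_mult)
    then have "mu_num s lam phi i = q" using False q(1) by (simp add: mu_num_def field_simps)
    with q show ?thesis by simp
  qed
  then show "lam i \<le> mu_num s lam phi i" "i < s \<Longrightarrow> mu_num s lam phi i < lam (Suc i)" by auto
qed

end

section \<open>Newton regions and uniqueness\<close>

text \<open>This is the set \<open>N_set\<close> after cancelling positive factors; keeping both
  slopes as parameters makes the regions additive in \<open>e\<close>.\<close>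

definition newton_region :: "nat \<Rightarrow> rat \<Rightarrow> rat \<Rightarrow> (nat \<times> nat) set" where
  "newton_region e lo hi = {(\<alpha>, \<beta>). of_nat \<alpha> + lo * of_nat \<beta> \<ge> of_nat e * lo \<and>
     of_nat \<alpha> + hi * of_nat \<beta> \<le> of_nat e * hi}"

lemma N_set_eq: "N_set s lam phi i = newton_region (e_num lam i) (lam 1) (mu_num s lam phi i)"
proof -
  have "k_num lam 1 > 0" using k_num_props(1)[OF e_num_pos lattice_iff, of lam 0] by simp
  then have k: "(of_nat (k_num lam 1) :: rat) > 0" by simp
  have e: "(of_nat (e_num lam i) :: rat) > 0" using e_num_pos[of lam i] by simp
  have "of_nat (e_num lam i) * (of_nat (k_num lam 1) * lam 1)
      \<le> of_nat (k_num lam 1) * \<alpha> + of_nat (k_num lam 1) * lam 1 * \<beta>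
    \<longleftrightarrow> of_nat (e_num lam i) * lam 1 \<le> \<alpha> + lam 1 * \<beta>" for \<alpha> \<beta> :: rat
    using mult_le_cancel_left_pos[OF k, of "of_nat (e_num lam i) * lam 1" "\<alpha> + lam 1 * \<beta>"]
    by (simp add: algebra_simps)
  moreover have "of_nat (e_num lam i) * \<alpha> + of_nat (e_num lam i) * \<mu> * \<beta> \<le>
       of_nat (e_num lam i) * (of_nat (e_num lam i) * \<mu>)
    \<longleftrightarrow> \<alpha> + \<mu> * \<beta> \<le> of_nat (e_num lam i) * \<mu>" for \<alpha> \<beta> \<mu> :: rat
    using mult_le_cancel_left_pos[OF e, of "\<alpha> + \<mu> * \<beta>" "of_nat (e_num lam i) * \<mu>"] by (simp add: algebra_simps)
  ultimately show ?thesis unfolding N_set_def newton_region_def Let_def by simp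
qed

text \<open>A monomial of a product is a sum of monomials of the factors, and the defining
  inequalities add up.\<close>

lemma supp2_mult_newton_region:
  assumes "supp2 g \<subseteq> newton_region a lo hi" and "supp2 h \<subseteq> newton_region b lo hi"
  shows "supp2 (g * h) \<subseteq> newton_region (a + b) lo hi"
proof
  fix x assume "x \<in> supp2 (g * h)"
  then obtain \<alpha> \<beta> where x: "x = (\<alpha>, \<beta>)" and nz: "coeff (coeff (g * h) \<beta>) \<alpha> \<noteq> 0"
    by (auto simp: supp2_def)
  then obtain m n where mn: "m \<le> \<beta>" "n \<le> \<alpha>" "coeff (coeff g m) n * coeff (coeff h (\<beta> - m)) (\<alpha> - n) \<noteq> 0"
    by (auto simp: coeff_mult coeff_sum elim!: sum.not_neutral_contains_not_neutral)
  then have "(n, m) \<in> newton_region a lo hi" "(\<alpha> - n, \<beta> - m) \<in> newton_region b lo hi"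
    using assms by (auto simp: supp2_def)
  with mn(1,2) show "x \<in> newton_region (a + b) lo hi"
    by (simp add: x newton_region_def of_nat_diff algebra_simps)
qed

lemma supp2_power_newton_region:
  assumes "supp2 g \<subseteq> newton_region e lo hi"
  shows "supp2 (g ^ k) \<subseteq> newton_region (k * e) lo hi"
proof (induction k)
  case 0
  show ?case by (auto simp: supp2_def newton_region_def split: if_splits)
next
  case (Suc k)
  from supp2_mult_newton_region[OF assms Suc] show ?case by simp
qed

lemma newton_region_degree:
  assumes "(\<alpha>, \<beta>) \<in> newton_region e lo hi" and "hi > 0"
  shows "\<beta> \<le> e" and "\<beta> = e \<Longrightarrow> \<alpha> = 0"
proof -
  have "hi * of_nat \<beta> \<le> of_nat \<alpha> + hi * of_nat \<beta>" by simp
  also have "\<dots> \<le> hi * of_nat e" using assms(1) by (simp add: newton_region_def mult.commute)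
  finally show "\<beta> \<le> e" using assms(2) by simp
  show "\<alpha> = 0" if "\<beta> = e" using assms(1) that by (simp add: newton_region_def mult.commute)
qed

text \<open>The upper inequality bounds \<open>\<alpha>\<close> by \<open>hi\<close> times
  \<open>e - \<beta>\<close>, and this difference is nonnegative.\<close>

lemma newton_region_mono:
  assumes "0 < hi" and "hi \<le> hi'"
  shows "newton_region e lo hi \<subseteq> newton_region e lo hi'"
proof
  fix x assume x: "x \<in> newton_region e lo hi"
  obtain \<alpha> \<beta> where ab: "x = (\<alpha>, \<beta>)" by (cases x)
  have "\<beta> \<le> e" using newton_region_degree(1)[OF _ assms(1)] x ab by blast
  then have "(of_nat e - of_nat \<beta>) * hi \<le> (of_nat e - of_nat \<beta>) * hi'"
    using assms(2) by (intro mult_left_mono) auto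
  with x show "x \<in> newton_region e lo hi'" by (simp add: ab newton_region_def algebra_simps)
qed

lemma supp2_diff_subset:
  assumes "supp2 g \<subseteq> A" and "supp2 h \<subseteq> A"
  shows "supp2 (g - h) \<subseteq> A"
  using assms by (fastforce simp: supp2_def)

lemma supp2_diff_monic_subset:
  assumes "supp2 g \<subseteq> A" and "supp2 h \<subseteq> A"
    and "degree g = d" and "lead_coeff g = 1" and "degree h = d" and "lead_coeff h = 1"
  shows "supp2 (g - h) \<subseteq> A - {(0, d)}"
  using supp2_diff_subset[OF assms(1,2)] assms(3-6) by (auto simp: supp2_def)

text \<open>The Newton region forces degree at most \<open>E i\<close> in the outer variable and a
  constant coefficient \<open>a\<close> there. Subtracting \<open>a\<close> times \<open>f\<close>
  lowers the degree and keeps the pullback zero, so the difference is zero.\<close>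

lemma (in char_data) supp2_eq_smult:
  assumes i: "i \<in> {1..s}" and f: "pullback (iota_trunc s lam c phi i) f = 0" "weierstrass_poly (E i) f"
    and g: "g \<noteq> 0" "pullback (iota_trunc s lam c phi i) g = 0" "supp2 g \<subseteq> N_set s lam phi i"
  shows "\<exists>a. a \<noteq> 0 \<and> g = smult [:a:] f"
proof -
  have mu: "mu_num s lam phi i > 0" using mu_num_bounds(1)[OF i] lam_pos[OF i] by simp
  have supp: "\<beta> \<le> E i" "\<beta> = E i \<Longrightarrow> \<alpha> = 0" if "coeff (coeff g \<beta>) \<alpha> \<noteq> 0" for \<alpha> \<beta>
  proof -
    have "(\<alpha>, \<beta>) \<in> newton_region (E i) (lam 1) (mu_num s lam phi i)"
      using that g(3) by (auto simp: supp2_def N_set_eq)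
    from newton_region_degree[OF this mu] show "\<beta> \<le> E i" "\<beta> = E i \<Longrightarrow> \<alpha> = 0" .
  qed
  define a where "a = coeff (coeff g (E i)) 0"
  have "coeff (coeff g (E i)) \<alpha> = coeff [:a:] \<alpha>" for \<alpha>
    using supp(2)[of "E i" \<alpha>] by (cases \<alpha>) (auto simp: a_def)
  then have "coeff g (E i) = [:a:]" by (intro poly_eqI)
  then have top: "coeff (g - smult [:a:] f) (E i) = 0" by (simp add: weierstrass_polyD[OF f(2)])
  have "degree g \<le> E i"
  proof (rule degree_le, intro allI impI)
    fix n assume "E i < n"
    then show "coeff g n = 0" using supp(1)[of n] by (intro poly_eqI) force
  qed
  then have "degree (g - smult [:a:] f) \<le> E i"
    using f(2) by (intro degree_diff_le order.trans[OF degree_smult_le]) (auto simp: weierstrass_poly_def)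
  with top have "degree (g - smult [:a:] f) < E i"
    by (metis E_pos degree_0 le_neq_implies_less leading_coeff_0_iff)
  then have "g - smult [:a:] f = 0"
    using i f(1) g(2) by (intro pullback_eq_0_imp_eq_0[of i]) (auto simp: pullback_diff_smult)
  then have "g = smult [:a:] f" by simp
  with g(1) show ?thesis by auto
qed

section \<open>Assembly of the claims\<close>

theorem theorem8:
  fixes s :: nat
    and lam :: "nat \<Rightarrow> rat"
    and c :: "nat \<Rightarrow> complex"
    and phi :: "nat \<Rightarrow> complex poly"
    and psi :: "complex fps"
    and iota :: "complex fps \<times> complex fps"
    and f :: "nat \<Rightarrow> complex poly poly"
  assumes "s \<ge> 1"
    and "\<forall>i\<in>{1..s}. lam i > 0"
    and "strict_mono_on {1..s} lam"
    and "lam 1 > 1"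
    and "\<forall>i\<in>{1..s}. lam i \<notin> lattice lam (i - 1)"
    and "\<forall>i\<in>{1..s}. c i \<noteq> 0"
    and "\<forall>i\<in>{1..<s}. coeff (phi i) 0 = 0"
    and "\<forall>i\<in>{1..<s}. \<forall>n\<in>poly_supp (phi i).
           of_nat n \<in> (\<lambda>m. of_nat (e_num lam s) * m) ` lattice lam i \<and>
           of_nat n > of_nat (e_num lam s) * lam i \<and>
           of_nat n < of_nat (e_num lam s) * lam (i + 1)"
    and "fps_nth psi 0 = 0"
    and "fps_conv_radius psi > 0"
    and "\<forall>n\<in>fps_supp psi.
           of_nat n \<in> (\<lambda>m. of_nat (e_num lam s) * m) ` lattice lam s \<and>
           of_nat n > of_nat (e_num lam s) * lam s"
    and "poly_supp (phi s) \<subseteq> fps_supp psi"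
    and "iota = iota_full s lam c phi psi"
    and "f 0 = [:0, 1:]"
    and "\<forall>i\<in>{1..s}. pullback (iota_trunc s lam c phi i) (f i) = 0"
    and "\<forall>i\<in>{1..s}. supp2 (f i) \<subseteq> N_set s lam phi i"
    and "\<forall>i\<in>{1..s}. weierstrass_poly (e_num lam i) (f i)"
  shows "\<forall>i\<in>{1..s}.
      (\<exists>\<delta> :: complex poly poly.
         supp2 \<delta> \<subseteq> N_set s lam phi i - {(0, e_num lam i)} \<and>
         f i = f (i - 1) ^ k_num lam i + \<delta>) \<and>
      (\<forall>j\<in>{i..s}.
         ereal_of_enat (theta (iota_trunc s lam c phi j) (f (i - 1)))
           = ereal (of_rat (gamma_num lam j i)) \<and>
         ereal_of_enat (theta (iota_trunc s lam c phi j) (pderiv (f (i - 1))))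
           = ereal (of_rat (gamma_num lam j i - of_nat (e_num lam j) * lam i))) \<and>
      (\<forall>g :: complex poly poly.
         g \<noteq> 0 \<longrightarrow>
         pullback (iota_trunc s lam c phi i) g = 0 \<longrightarrow>
         supp2 g \<subseteq> N_set s lam phi i \<longrightarrow>
         (\<exists>a :: complex. a \<noteq> 0 \<and> g = smult [:a:] (f i)))"
proof -
  interpret char_data s lam c phi
  proof
    show "strict_mono_on {1..s} lam" by fact
    show "lam i > 0" "c i \<noteq> 0" if "i \<in> {1..s}" for i using assms(2,6) that by auto
    have e: "(of_nat (e_num lam s) :: rat) > 0" using e_num_pos[of lam s] by simp
    show "\<exists>q\<in>lattice lam i. of_nat n = of_nat (e_num lam s) * q \<and> lam i < q \<and> (i < s \<longrightarrow> q < lam (Suc i))"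
      if "i \<in> {1..s}" "n \<in> poly_supp (phi i)" for i n
    proof (cases "i < s")
      case True
      then have "i \<in> {1..<s}" using that by auto
      with assms(8) that(2) obtain q where q: "q \<in> lattice lam i" "of_nat n = of_nat (e_num lam s) * q"
        "of_nat n > of_nat (e_num lam s) * lam i" "of_nat n < of_nat (e_num lam s) * lam (i + 1)"
        by blast
      with e show ?thesis by auto
    next
      case False
      then have "i = s" using that by auto
      with assms(11,12) that(2) obtain q where q: "q \<in> lattice lam i" "of_nat n = of_nat (e_num lam s) * q"
        "of_nat n > of_nat (e_num lam s) * lam i" by blast
      with e \<open>i = s\<close> show ?thesis by auto
    qed
  qed
  \<comment> \<open>For \<open>i = 0\<close> the truncation is $(t, 0)$ and $f_0 = y$, so the general lemmas cover $f_{i-1}$ for $i = 1$.\<close>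
  have pull: "pullback (iota_trunc s lam c phi i) (f i) = 0"
    and wst: "weierstrass_poly (E i) (f i)" if "i \<le> s" for i
  proof -
    have "pullback (iota_trunc s lam c phi 0) (f 0) = 0" "weierstrass_poly (E 0) (f 0)"
      using assms(14)
      by (simp_all add: pullback_def iota_trunc_def weierstrass_poly_def map_poly_pCons)
    then show "pullback (iota_trunc s lam c phi i) (f i) = 0" "weierstrass_poly (E i) (f i)"
      using that assms(15,17) by (cases "i = 0"; auto)+
  qed
  show ?thesis
  proof (intro ballI conjI allI impI)
    fix i assume i: "i \<in> {1..s}"
    then obtain m where m: "i = Suc m" "m < s" by (cases i) auto
    have lead: "lead_coeff (f m) = 1" and deg: "degree (f m) = E m"
      using weierstrass_polyD[OF wst[of m]] m by simp_all
    then have "f m \<noteq> 0" by auto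
    then have "degree (f m ^ k_num lam i) = E i" by (simp add: degree_power_eq deg m)
    have mu_i: "mu_num s lam phi i \<ge> lam i" by (rule mu_num_bounds(1)[OF i])
    \<comment> \<open>The region of level \<open>m\<close> must fit inside that of level
      \<open>i\<close>. For \<open>m = 0\<close> the support of \<open>f 0\<close> is the single
      corner point, so \<open>lam i\<close> can serve as slope; otherwise the slope
      \<open>mu_num s lam phi m\<close> is below \<open>lam i\<close>.\<close>
    have "\<exists>hi. 0 < hi \<and> hi \<le> mu_num s lam phi i \<and> supp2 (f m) \<subseteq> newton_region (E m) (lam 1) hi"
    proof (cases m)
      case 0
      have "supp2 (f m) \<subseteq> newton_region (E m) (lam 1) (lam i)"
      proof -
        have "f m = monom 1 (Suc 0)" using assms(14) 0 by (simp add: monom_Suc monom_0)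
        then show ?thesis using 0 by (auto simp: supp2_def newton_region_def split: if_splits)
      qed
      with mu_i lam_pos[OF i] show ?thesis by blast
    next
      case (Suc n)
      then have "m \<in> {1..s}" using m by auto
      with mu_num_bounds[OF this] lam_pos[OF this] mu_i m assms(16) show ?thesis
        unfolding N_set_eq by (intro exI[of _ "mu_num s lam phi m"]) auto
    qed
    then obtain hi where "0 < hi" "hi \<le> mu_num s lam phi i" "supp2 (f m) \<subseteq> newton_region (E m) (lam 1) hi"
      by blast
    \<comment> \<open>As \<open>k_num lam i * E m = E i\<close>, the power has the right height;
      enlarging the slope then gives \<open>N_set\<close>.\<close>
    then have "supp2 (f m ^ k_num lam i) \<subseteq> N_set s lam phi i"
      using supp2_power_newton_region newton_region_mono unfolding N_set_eq m by fastforce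
    moreover have "supp2 (f i) \<subseteq> N_set s lam phi i" using assms(16) i by blast
    moreover have "degree (f m ^ k_num lam i) = E i" by fact
    moreover have "lead_coeff (f m ^ k_num lam i) = 1" by (simp only: lead_coeff_power lead power_one)
    \<comment> \<open>Both polynomials are monic of degree \<open>E i\<close>, so the corner
      \<open>(0, E i)\<close> cancels in the difference, which is the required
      \<open>\<delta>\<close>.\<close>
    ultimately have "supp2 (f i - f m ^ k_num lam i) \<subseteq> N_set s lam phi i - {(0, E i)}"
      using wst[of i] i by (intro supp2_diff_monic_subset) (auto simp: weierstrass_poly_def)
    then show "\<exists>\<delta>. supp2 \<delta> \<subseteq> N_set s lam phi i - {(0, E i)} \<and> f i = f (i - 1) ^ k_num lam i + \<delta>"
      by (intro exI[of _ "f i - f m ^ k_num lam i"]) (simp add: m)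
    show "ereal_of_enat (theta (iota_trunc s lam c phi j) (f (i - 1))) = ereal (of_rat (gamma_num lam j i))"
      "ereal_of_enat (theta (iota_trunc s lam c phi j) (pderiv (f (i - 1)))) =
         ereal (of_rat (gamma_num lam j i - of_nat (E j) * lam i))" if "j \<in> {i..s}" for j
      using that m pull[of m] wst[of m] theta_truncation[of m j "f m"] theta_pderiv_truncation[of m j "f m"]
      by auto
    show "\<exists>a. a \<noteq> 0 \<and> g = smult [:a:] (f i)" if "g \<noteq> 0"
      "pullback (iota_trunc s lam c phi i) g = 0" "supp2 g \<subseteq> N_set s lam phi i" for g
      using supp2_eq_smult[OF i pull wst that] i by auto
  qed
qed

end
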